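(* Let $X$ be an abstract simplicial complex with vertex set $\{1,\ldots,k\}$, $k\ge 1$, and let $n\geq 1$ be an integer. Let $L(n,X)$ be the simplicial complex whose vertices are the minimal elements of the poset $\mathcal{S}(n,X)$ and whose faces are those collections of minimal elements that can be dominated by some element of $\mathcal{S}(n,X)$. Then there is a homotopy equivalence $$|L(n,X)| \simeq \operatorname{Conf}(n, C^{\circ}|X|),$$ where $C^{\circ}|X|$ denotes the open cone on the geometric realization $|X|$ of $X$.
   Context: For a topological space $Z$, the configuration space is $\operatorname{Conf}(n,Z)=\{(z_1,\ldots,z_n)\in Z^n : z_i\neq z_j \text{ whenever } i\neq j\}$, with the subspace topology. $|X|$ denotes geometric realization. The open cone $C^\circ|X|$ is the quotient of $|X|\times[0,\infty)$ collapsing $|X|\times\{0\}$ to a point; equivalently (up to homeomorphism) it is the subspace of $\mathbb{R}^k$ of all $(\alpha_1,\ldots,\alpha_k)$ with every $\alpha_i\ge 0$ and $\{i:\alpha_i>0\}$ either empty or a face of $X$. Let $\mathcal{P}(n)$ be the set of all poset structures (partial orders) on the set $\{1,\ldots,n\}$, itself partially ordered by $\preceq$, inclusion of relations: $P\preceq Q$ if $a\le_P b$ implies $a\le_Q b$ for all $a,b$. For a $k$-tuple $(S_1,\ldots,S_k)\in\mathcal{P}(n)^k$ and $i\in\{1,\ldots,n\}$, the support of $i$ is $$\sigma_i(S_1,\ldots,S_k)=\{v\in\{1,\ldots,k\} : i \text{ is not a minimal element of the poset } S_v\}.$$ The poset $\mathcal{S}(n,X)\subseteq\mathcal{P}(n)^k$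 consists of the tuples $(S_1,\ldots,S_k)$ such that (1) for every $i,j\in\{1,\ldots,n\}$ there is some $v \in \{1,\ldots,k\}$ such that $i$ and $j$ are comparable in $S_v$; and (2) for every $i\in\{1,\ldots,n\}$, the support $\sigma_i(S_1,\ldots,S_k)\subseteq\{1,\ldots,k\}$ is a face of $X$, where the empty set counts as a face of $X$. It is ordered by imposing $\preceq$ in every coordinate. A nonempty collection of minimal elements of $\mathcal{S}(n,X)$ is dominated by $T\in\mathcal{S}(n,X)$ if every member of the collection is less than or equal to $T$ in $\mathcal{S}(n,X)$. *)

theory Defs
  imports "HOL-Analysis.Analysis"
begin

text \<open>All vertices are required to be faces, and the empty set counts as a face.\<close>

definition simplicial_complex_on :: "'v set \<Rightarrow> 'v set set \<Rightarrow> bool" where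
  "simplicial_complex_on V K \<longleftrightarrow>
     K \<subseteq> Pow V \<and> (\<forall>\<sigma>\<in>K. finite \<sigma>) \<and> {} \<in> K \<and> (\<forall>v\<in>V. {v} \<in> K) \<and>
     (\<forall>\<sigma>\<in>K. \<forall>\<tau>. \<tau> \<subseteq> \<sigma> \<longrightarrow> \<tau> \<in> K)"

text \<open>
  Barycentric coordinates with the topology of pointwise convergence. On complexes with finitely
  many vertices, the only ones that occur here, this is the weak (coherent) topology.
\<close>

definition realization_points :: "'v set set \<Rightarrow> ('v \<Rightarrow> real) set" where
  "realization_points K =
     {\<alpha>. (\<forall>v. 0 \<le> \<alpha> v) \<and> {v. \<alpha> v \<noteq> 0} \<in> K \<and> (\<Sum>v | \<alpha> v \<noteq> 0. \<alpha> v) = 1}"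

definition geometric_realization :: "'v set set \<Rightarrow> ('v \<Rightarrow> real) topology" where
  "geometric_realization K = top_of_set (realization_points K)"

definition quotient_topology :: "'a topology \<Rightarrow> ('a \<times> 'a) set \<Rightarrow> 'a set topology" where
  "quotient_topology Z r = topology (\<lambda>U. U \<subseteq> topspace Z // r \<and> openin Z (\<Union>U))"

lemma openin_quotient_topology:
  assumes "equiv (topspace Z) r"
  shows "openin (quotient_topology Z r) U \<longleftrightarrow> U \<subseteq> topspace Z // r \<and> openin Z (\<Union>U)"
proof -
  have "\<Union>(U \<inter> V) = \<Union>U \<inter> \<Union>V"
    if "U \<subseteq> topspace Z // r" "V \<subseteq> topspace Z // r" for U V
    using that quotient_disj[OF assms] by blast
  then have "istopology (\<lambda>U. U \<subseteq> topspace Z // r \<and> openin Z (\<Union>U))"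
    unfolding istopology_def
  proof (intro conjI allI impI)
    fix \<U> assume "\<forall>U\<in>\<U>. U \<subseteq> topspace Z // r \<and> openin Z (\<Union>U)"
    moreover have "\<Union>(\<Union>\<U>) = (\<Union>U\<in>\<U>. \<Union>U)" by blast
    ultimately show "openin Z (\<Union>(\<Union>\<U>))" by auto
  qed auto
  then show ?thesis
    by (simp add: quotient_topology_def)
qed

definition collapse_rel :: "'a set \<Rightarrow> 'a set \<Rightarrow> ('a \<times> 'a) set" where
  "collapse_rel S A = {(p, q). p \<in> S \<and> q \<in> S \<and> (p = q \<or> p \<in> A \<and> q \<in> A)}"

lemma equiv_collapse_rel: "equiv S (collapse_rel S A)"
  by (rule equivI) (auto simp: collapse_rel_def refl_on_def sym_def trans_def)

definition open_cone :: "'a topology \<Rightarrow> ('a \<times> real) set topology" where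
  "open_cone Z =
     (let C = prod_topology Z (top_of_set {0..})
      in quotient_topology C (collapse_rel (topspace C) (topspace Z \<times> {0})))"

definition Conf :: "nat \<Rightarrow> 'a topology \<Rightarrow> (nat \<Rightarrow> 'a) topology" where
  "Conf n Z = subtopology (product_topology (\<lambda>_. Z) {1..n}) {z. inj_on z {1..n}}"

definition poset_structures :: "nat \<Rightarrow> nat rel set" where
  "poset_structures n = {P. partial_order_on {1..n} P}"

text \<open>A pair \<open>(j, i)\<close> in a relation means \<open>j \<le> i\<close>.\<close>

definition support :: "nat \<Rightarrow> (nat \<Rightarrow> nat rel) \<Rightarrow> nat \<Rightarrow> nat set" where
  "support k S i = {v \<in> {1..k}. \<not> (\<forall>j. (j, i) \<in> S v \<longrightarrow> j = i)}"

definition poset_tuples :: "nat \<Rightarrow> nat \<Rightarrow> nat set set \<Rightarrow> (nat \<Rightarrow> nat rel) set" where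
  "poset_tuples n k X =
     {S \<in> {1..k} \<rightarrow>\<^sub>E poset_structures n.
        (\<forall>i\<in>{1..n}. \<forall>j\<in>{1..n}. \<exists>v\<in>{1..k}. (i, j) \<in> S v \<or> (j, i) \<in> S v) \<and>
        (\<forall>i\<in>{1..n}. support k S i \<in> X)}"

definition tuple_le :: "nat \<Rightarrow> (nat \<Rightarrow> nat rel) \<Rightarrow> (nat \<Rightarrow> nat rel) \<Rightarrow> bool" where
  "tuple_le k S T \<longleftrightarrow> (\<forall>v\<in>{1..k}. S v \<subseteq> T v)"

definition minimal_tuples :: "nat \<Rightarrow> nat \<Rightarrow> nat set set \<Rightarrow> (nat \<Rightarrow> nat rel) set" where
  "minimal_tuples n k X =
     {S \<in> poset_tuples n k X. \<forall>T\<in>poset_tuples n k X. tuple_le k T S \<longrightarrow> T = S}"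

text \<open>
  The empty collection is included, in line with the convention that the empty set is a face; it
  contributes no point to the realization.
\<close>

definition domination_complex ::
    "nat \<Rightarrow> nat \<Rightarrow> nat set set \<Rightarrow> (nat \<Rightarrow> nat rel) set set" where
  "domination_complex n k X =
     {M. M \<subseteq> minimal_tuples n k X \<and> (\<exists>T\<in>poset_tuples n k X. \<forall>S\<in>M. tuple_le k S T)}"

end

theory Submission
  imports Defs
begin

text \<open>
  Write the open cone as the set of nonnegative vectors supported on a face of \<open>X\<close>
  (\<open>open_cone_homeomorphic_cone_points\<close>). To a tuple \<open>S\<close> of orders belongs its chamber, the open set
  of those configurations whose \<open>v\<close>-th coordinates strictly increase along \<open>S v\<close>. Conversely a
  configuration \<open>z\<close> has an order type, the tuple of orders given by comparing coordinates, and order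
  types belong to the poset of tuples. In the poset, comparability of any two points in some order
  makes the points of a configuration in the chamber distinct, while the condition on supports makes
  the chamber nonempty. Moreover \<open>z\<close> lies in the chamber of \<open>S\<close> iff \<open>S\<close> is below the
  order type of \<open>z\<close> (\<open>chamber_iff\<close>). So the chambers of the minimal tuples cover the configuration
  space, and a set of minimal tuples is dominated iff its chambers meet. The nonempty intersections of
  these chambers are star-shaped, and the domination complex is the nerve of a good open cover.

  Rather than appeal to a general nerve theorem, the proof gives explicit homotopy inverses. One
  direction, \<open>nerve_map\<close>, is a partition of unity subordinate to the cover. In the other direction,
  \<open>config_map\<close> sends a point \<open>\<alpha>\<close> of the realization to a weighted sum of configurations, one for each
  face spanned by its support. With suitable weights the result lies in the chamber of every
  vertex \<open>M\<close> whose coordinate \<open>\<alpha> M\<close> is not too small (\<open>config_map_in_chamber\<close>), and the supports of its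
  points stay within those prescribed by the vertices of the face.

  This one property makes both composites homotopic to the identity. A configuration and its image
  share a chamber and can be joined by a segment. On the realization, \<open>\<alpha>\<close> and its image need not lie in
  a common face, but the vertices at which \<open>\<alpha>\<close> is not too small belong to the supports of both. One
  passes through the point obtained from \<open>\<alpha>\<close> by truncating the small coordinates, in two straight-line
  homotopies.
\<close>

section \<open>The open cone in coordinates\<close>

text \<open>
  Each of the two quotient maps factors through the other, and the two factors are mutually inverse.
\<close>

lemma homeomorphic_space_if_quotient_maps_same_fibres:
  assumes f: "quotient_map X Y f" and g: "quotient_map X Z g"
    and fibres: "\<And>x y. x \<in> topspace X \<Longrightarrow> y \<in> topspace X \<Longrightarrow> f x = f y \<longleftrightarrow> g x = g y"
  shows "Y homeomorphic_space Z"
proof -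
  obtain h where h: "continuous_map Y Z h" "\<And>x. x \<in> topspace X \<Longrightarrow> h (f x) = g x"
    using quotient_map_lift_exists[OF f quotient_imp_continuous_map[OF g]] fibres by metis
  obtain h' where h': "continuous_map Z Y h'" "\<And>x. x \<in> topspace X \<Longrightarrow> h' (g x) = f x"
    using quotient_map_lift_exists[OF g quotient_imp_continuous_map[OF f]] fibres by metis
  have "f ` topspace X = topspace Y" "g ` topspace X = topspace Z"
    using f g by (auto simp: quotient_map_def)
  then have "homeomorphic_maps Y Z h h'"
    unfolding homeomorphic_maps_def using h h' by (metis imageE)
  then show ?thesis
    by (auto simp: homeomorphic_space_def)
qed

lemma quotient_map_quotient_topology:
  assumes "equiv (topspace Z) r"
  shows "quotient_map Z (quotient_topology Z r) (\<lambda>x. r `` {x})"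
proof -
  have top: "topspace (quotient_topology Z r) = topspace Z // r"
  proof
    show "topspace (quotient_topology Z r) \<subseteq> topspace Z // r"
      using openin_quotient_topology[OF assms] openin_topspace by blast
    have "openin (quotient_topology Z r) (topspace Z // r)"
      by (simp add: openin_quotient_topology assms Union_quotient)
    then show "topspace Z // r \<subseteq> topspace (quotient_topology Z r)"
      by (rule openin_subset)
  qed
  have "{x \<in> topspace Z. r `` {x} \<in> U} = \<Union>U" if "U \<subseteq> topspace Z // r" for U
  proof (intro equalityI subsetI)
    fix x assume "x \<in> {x \<in> topspace Z. r `` {x} \<in> U}"
    then show "x \<in> \<Union>U" using equiv_class_self[OF assms] by blast
  next
    fix x assume "x \<in> \<Union>U"
    then obtain u where u: "u \<in> U" "x \<in> u" by blast
    then obtain y where "y \<in> topspace Z" "u = r `` {y}"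
      using \<open>U \<subseteq> topspace Z // r\<close> by (blast elim: quotientE)
    with u have "r `` {x} = u" "x \<in> topspace Z"
      using equiv_class_eq[OF assms] assms equiv_type by fastforce+
    with u show "x \<in> {x \<in> topspace Z. r `` {x} \<in> U}" by simp
  qed
  then show ?thesis
    unfolding quotient_map_def top
    by (auto simp: openin_quotient_topology[OF assms] quotient_def)
qed

text \<open>
  The coordinate model of the open cone on $|X|$: a point of $|X|$ scaled by a nonnegative factor.
\<close>

definition cone_points :: "'v set set \<Rightarrow> ('v \<Rightarrow> real) set" where
  "cone_points X = {\<beta>. (\<forall>v. 0 \<le> \<beta> v) \<and> {v. \<beta> v \<noteq> 0} \<in> X}"

lemma mem_realization_points_iff:
  assumes K: "simplicial_complex_on V K" and "finite V"
  shows "\<alpha> \<in> realization_points K \<longleftrightarrow> \<alpha> \<in> cone_points K \<and> (\<Sum>v\<in>V. \<alpha> v) = 1"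
proof -
  have "(\<Sum>v | \<alpha> v \<noteq> 0. \<alpha> v) = (\<Sum>v\<in>V. \<alpha> v)" if "{v. \<alpha> v \<noteq> 0} \<in> K"
    using that assms by (intro sum.mono_neutral_left) (auto simp: simplicial_complex_on_def)
  then show ?thesis
    by (auto simp: realization_points_def cone_points_def)
qed

lemma sum_pos_cone_points:
  assumes K: "simplicial_complex_on V K" "finite V"
    and w: "w \<in> cone_points K" "w v \<noteq> 0"
  shows "(\<Sum>v\<in>V. w v) > 0"
proof -
  have "v \<in> V" using K w by (auto simp: simplicial_complex_on_def cone_points_def)
  moreover have "w v > 0" using w by (auto simp: cone_points_def less_le)
  ultimately show ?thesis
    using K w by (intro sum_pos2[of V v]) (auto simp: cone_points_def)
qed

lemma normalized_mem_realization_points: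
  assumes K: "simplicial_complex_on V K" "finite V"
    and w: "w \<in> cone_points K" "w v \<noteq> 0"
  shows "(\<lambda>v. w v / (\<Sum>v\<in>V. w v)) \<in> realization_points K"
  using sum_pos_cone_points[OF assms] w
  by (auto simp: mem_realization_points_iff[OF K] cone_points_def sum_divide_distrib[symmetric])

lemma continuous_on_coordinate [continuous_intros]:
  "continuous_on S (\<lambda>x. x i :: 'b::topological_space)"
  by (rule continuous_on_product_then_coordinatewise[OF continuous_on_id])

lemma continuous_on_fst_coordinate: "continuous_on S (\<lambda>p. fst p v :: 'b::topological_space)"
  by (rule continuous_on_product_then_coordinatewise[OF continuous_on_fst[OF continuous_on_id]])

lemma continuous_on_snd_coordinate: "continuous_on S (\<lambda>p. snd p v :: 'b::topological_space)"
  by (rule continuous_on_product_then_coordinatewise[OF continuous_on_snd[OF continuous_on_id]])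

text \<open>
  With finitely many vertices, $|K|$ is a finite union of closed sets, one for each face, inside a
  cube, which is compact by Tychonoff's theorem.
\<close>

lemma compact_realization_points:
  fixes K :: "'a set set"
  assumes K: "simplicial_complex_on V K" and V: "finite V"
  shows "compact (realization_points K)"
proof -
  define face_points :: "'a set \<Rightarrow> ('a \<Rightarrow> real) set" where
    "face_points \<sigma> = {\<alpha>. (\<forall>v. 0 \<le> \<alpha> v) \<and> (\<forall>v. v \<in> \<sigma> \<or> \<alpha> v = 0) \<and> (\<Sum>v\<in>V. \<alpha> v) = 1}" for \<sigma>
  have "closed (face_points \<sigma>)" for \<sigma>
    unfolding face_points_def
    by (intro closed_Collect_conj closed_Collect_all closed_Collect_disj closed_Collect_le
        closed_Collect_eq closed_Collect_const continuous_intros)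
  moreover have "finite K"
    using K V by (meson finite_Pow_iff finite_subset simplicial_complex_on_def)
  moreover have "realization_points K = (\<Union>\<sigma>\<in>K. face_points \<sigma>)"
  proof -
    have "\<alpha> \<in> cone_points K" if "\<alpha> \<in> face_points \<sigma>" "\<sigma> \<in> K" for \<alpha> \<sigma>
    proof -
      have "{v. \<alpha> v \<noteq> 0} \<subseteq> \<sigma>" using that by (auto simp: face_points_def)
      then have "{v. \<alpha> v \<noteq> 0} \<in> K" using that K by (auto simp: simplicial_complex_on_def)
      then show ?thesis using that by (simp add: cone_points_def face_points_def)
    qed
    moreover have "\<alpha> \<in> face_points {v. \<alpha> v \<noteq> 0}" if "\<alpha> \<in> realization_points K" for \<alpha>
      using that mem_realization_points_iff[OF K V] by (auto simp: face_points_def cone_points_def)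
    moreover have "{v. \<alpha> v \<noteq> 0} \<in> K" if "\<alpha> \<in> realization_points K" for \<alpha>
      using that by (simp add: realization_points_def)
    moreover have "(\<Sum>v\<in>V. \<alpha> v) = 1" if "\<alpha> \<in> face_points \<sigma>" for \<alpha> \<sigma>
      using that by (simp add: face_points_def)
    ultimately show ?thesis
      using mem_realization_points_iff[OF K V] by blast
  qed
  ultimately have closed: "closed (realization_points K)"
    by auto
  have "compactin (product_topology (\<lambda>_. euclidean) UNIV) (PiE UNIV (\<lambda>_::'a. {0..1::real}))"
    by (simp add: compactin_PiE)
  then have "compact (PiE UNIV (\<lambda>_::'a. {0..1::real}))"
    by (simp add: euclidean_product_topology)
  moreover have "realization_points K \<subseteq> PiE UNIV (\<lambda>_. {0..1})"
  proof
    fix \<alpha> assume \<alpha>: "\<alpha> \<in> realization_points K"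
    have "\<alpha> v \<le> 1" for v
    proof (cases "v \<in> V")
      case True
      then have "\<alpha> v \<le> (\<Sum>v\<in>V. \<alpha> v)"
        using \<alpha> V by (intro member_le_sum) (auto simp: realization_points_def)
      then show ?thesis using \<alpha> mem_realization_points_iff[OF K V] by simp
    next
      case False
      then have "\<alpha> v = 0" using \<alpha> K by (auto simp: realization_points_def simplicial_complex_on_def)
      then show ?thesis by simp
    qed
    then show "\<alpha> \<in> PiE UNIV (\<lambda>_. {0..1})"
      using \<alpha> by (auto simp: realization_points_def)
  qed
  ultimately show ?thesis
    using closed by (metis compact_Int_closed inf.absorb_iff2)
qed

text \<open>
  Scaling, \<open>(\<alpha>, t) \<mapsto> t \<alpha>\<close>, collapses exactly \<open>|X| \<times> {0}\<close>, so it only has to be shown that it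
  is a quotient map onto the coordinate model. It is even a closed map, because $|X|$ is compact: up
  to the homeomorphism \<open>(\<alpha>, t) \<mapsto> (\<alpha>, t \<alpha>)\<close> onto a closed set it is a projection along $|X|$.
\<close>

lemma open_cone_homeomorphic_cone_points:
  fixes X :: "'v set set"
  assumes X: "simplicial_complex_on V X" and V: "finite V" "V \<noteq> {}"
  shows "open_cone (geometric_realization X) homeomorphic_space top_of_set (cone_points X)"
proof -
  define C where "C = prod_topology (geometric_realization X) (top_of_set {0::real..})"
  let ?R = "realization_points X"
  define r where "r = collapse_rel (topspace C) (?R \<times> {0})"
  define m where "m = (\<lambda>(\<alpha> :: 'v \<Rightarrow> real, t::real). \<lambda>v. t * \<alpha> v :: real)"
  \<comment> \<open>The cone parameter \<open>t\<close> of \<open>m (\<alpha>, t)\<close> is recovered as the total mass.\<close>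
  define mass where "mass \<beta> = (\<Sum>v\<in>V. \<beta> v)" for \<beta> :: "'v \<Rightarrow> real"
  have C: "C = top_of_set (?R \<times> {0..})"
    unfolding C_def geometric_realization_def by simp
  note R = mem_realization_points_iff[OF X V(1)]
  have mass_m: "mass (m (\<alpha>, t)) = t" if "\<alpha> \<in> ?R" for \<alpha> t
    using that R by (simp add: mass_def m_def sum_distrib_left[symmetric])
  have mass_nonneg: "mass \<beta> \<ge> 0" if "\<beta> \<in> cone_points X" for \<beta>
    using that by (auto simp: mass_def cone_points_def intro: sum_nonneg)
  have m_in: "m p \<in> cone_points X" if p: "p \<in> ?R \<times> {0..}" for p
  proof -
    obtain \<alpha> t where p_eq: "p = (\<alpha>, t)" and \<alpha>: "\<alpha> \<in> ?R" and t: "t \<ge> 0" using p by auto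
    have "{v. t * \<alpha> v \<noteq> 0} \<subseteq> {v. \<alpha> v \<noteq> 0}" by auto
    then have "{v. t * \<alpha> v \<noteq> 0} \<in> X"
      using \<alpha> X by (auto simp: realization_points_def simplicial_complex_on_def)
    then show ?thesis using \<alpha> t by (auto simp: p_eq m_def cone_points_def realization_points_def)
  qed
  \<comment> \<open>Some point of $|X|$ is needed to represent the apex; this is where \<open>V \<noteq> {}\<close> enters.\<close>
  obtain v\<^sub>0 where "v\<^sub>0 \<in> V" using V by blast
  then have base: "(\<lambda>v. if v = v\<^sub>0 then 1 else 0) \<in> ?R"
    using X V by (auto simp: R cone_points_def simplicial_complex_on_def)
  have normal: "\<exists>\<alpha>\<in>?R. \<beta> = m (\<alpha>, mass \<beta>)" if \<beta>: "\<beta> \<in> cone_points X" for \<beta>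
  proof (cases "\<exists>v. \<beta> v \<noteq> 0")
    case True
    then obtain v where v: "\<beta> v \<noteq> 0" by blast
    have "(\<lambda>v. \<beta> v / mass \<beta>) \<in> ?R" "mass \<beta> > 0"
      unfolding mass_def
      by (rule normalized_mem_realization_points[OF X V(1) \<beta> v] sum_pos_cone_points[OF X V(1) \<beta> v])+
    then show ?thesis by (intro bexI) (auto simp: m_def fun_eq_iff)
  next
    case False
    then show ?thesis using base by (auto simp: m_def mass_def fun_eq_iff)
  qed
  have cont_m: "continuous_map C (top_of_set (cone_points X)) m"
  proof -
    have "continuous_on (?R \<times> {0..}) m"
      unfolding m_def case_prod_unfold
      by (rule continuous_on_coordinatewise_then_product)
        (intro continuous_on_mult continuous_on_snd continuous_on_id continuous_on_fst_coordinate)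
    then show ?thesis using m_in by (auto simp: C)
  qed
  have surj_m: "m ` topspace C = topspace (top_of_set (cone_points X))"
  proof -
    have "\<beta> \<in> m ` (?R \<times> {0..})" if "\<beta> \<in> cone_points X" for \<beta>
      using normal[OF that] mass_nonneg[OF that] by auto
    then show ?thesis using m_in by (auto simp: C)
  qed
  have closed_m: "closed_map C (top_of_set (cone_points X)) m"
    unfolding closed_map_def
  proof (intro allI impI)
    fix D assume D: "closedin C D"
    let ?P = "?R \<times> cone_points X"
    \<comment> \<open>\<open>q\<close> inverts \<open>(\<alpha>, t) \<mapsto> (\<alpha>, t \<alpha>)\<close>, and \<open>G\<close> is the image of \<open>D\<close> under this embedding.\<close>
    define q where "q = (\<lambda>(\<alpha>::'v \<Rightarrow> real, \<beta>). (\<alpha>, mass \<beta>))"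
    define G where "G = {p \<in> ?P. q p \<in> D} \<inter> {p \<in> ?P. \<forall>v. snd p v = m (q p) v}"
    have D_sub: "D \<subseteq> ?R \<times> {0..}" using closedin_subset[OF D] by (simp add: C)
    have cont_mass: "continuous_on ?P (\<lambda>p. mass (snd p))"
      unfolding mass_def
      by (intro continuous_on_sum continuous_on_snd_coordinate)
    have "continuous_map (top_of_set ?P) C q"
    proof -
      have "continuous_on ?P q"
        unfolding q_def case_prod_unfold
        by (intro continuous_on_Pair continuous_on_fst continuous_on_id cont_mass)
      then show ?thesis using mass_nonneg by (auto simp: C q_def)
    qed
    then have "closedin (top_of_set ?P) {p \<in> ?P. q p \<in> D}"
      using D closedin_continuous_map_preimage by fastforce
    moreover have "closedin (top_of_set ?P) {p \<in> ?P. \<forall>v. snd p v = m (q p) v}"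
    proof -
      have "closedin (top_of_set ?P) {p \<in> ?P. snd p v - m (q p) v = 0}" for v
        unfolding m_def q_def case_prod_unfold fst_conv snd_conv
        by (intro continuous_closedin_preimage_constant continuous_on_diff continuous_on_mult cont_mass
            continuous_on_fst_coordinate continuous_on_snd_coordinate)
      then have "closedin (top_of_set ?P) (\<Inter>v. {p \<in> ?P. snd p v - m (q p) v = 0})"
        by (intro closedin_INT) auto
      also have "(\<Inter>v. {p \<in> ?P. snd p v - m (q p) v = 0}) = {p \<in> ?P. \<forall>v. snd p v = m (q p) v}"
        by auto
      finally show ?thesis .
    qed
    ultimately have "closedin (top_of_set ?P) G"
      unfolding G_def by (rule closedin_Int)
    then have "closedin (prod_topology (top_of_set ?R) (top_of_set (cone_points X))) G"
      by simp
    moreover have "closed_map (prod_topology (top_of_set ?R) (top_of_set (cone_points X)))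
        (top_of_set (cone_points X)) snd"
      using compact_realization_points[OF X V(1)]
      by (intro Abstract_Topological_Spaces.closed_map_snd compact_space_subtopology) simp
    ultimately have "closedin (top_of_set (cone_points X)) (snd ` G)"
      unfolding closed_map_def by blast
    moreover have "snd ` G = m ` D"
    proof
      show "snd ` G \<subseteq> m ` D"
      proof
        fix \<beta> assume "\<beta> \<in> snd ` G"
        then obtain \<alpha> where "(\<alpha>, \<beta>) \<in> G" by auto
        then have "q (\<alpha>, \<beta>) \<in> D" "\<beta> = m (q (\<alpha>, \<beta>))"
          by (auto simp: G_def)
        then show "\<beta> \<in> m ` D" by blast
      qed
      show "m ` D \<subseteq> snd ` G"
      proof
        fix \<beta> assume "\<beta> \<in> m ` D"
        then obtain \<alpha> t where p: "(\<alpha>, t) \<in> D" "\<beta> = m (\<alpha>, t)" by auto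
        moreover from p D_sub have "\<alpha> \<in> ?R" "m (\<alpha>, t) \<in> cone_points X" using m_in by auto
        ultimately have "(\<alpha>, \<beta>) \<in> G" by (auto simp: G_def q_def mass_m)
        then show "\<beta> \<in> snd ` G" by force
      qed
    qed
    ultimately show "closedin (top_of_set (cone_points X)) (m ` D)" by simp
  qed
  have "quotient_map C (top_of_set (cone_points X)) m"
    using continuous_closed_imp_quotient_map cont_m closed_m surj_m by blast
  moreover have "quotient_map C (quotient_topology C r) (\<lambda>x. r `` {x})"
    unfolding r_def by (intro quotient_map_quotient_topology equiv_collapse_rel)
  moreover have "r `` {p} = r `` {p'} \<longleftrightarrow> m p = m p'"
    if pp: "p \<in> topspace C" "p' \<in> topspace C" for p p'
  proof -
    obtain \<alpha> t \<alpha>' t' where p: "p = (\<alpha>, t)" "p' = (\<alpha>', t')" by (meson surj_pair)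
    have R_in: "\<alpha> \<in> ?R" "\<alpha>' \<in> ?R" using pp by (auto simp: p C)
    have "r `` {p} = r `` {p'} \<longleftrightarrow> (p, p') \<in> r"
      using pp unfolding r_def by (rule eq_equiv_class_iff[OF equiv_collapse_rel])
    also have "\<dots> \<longleftrightarrow> p = p' \<or> (t = 0 \<and> t' = 0)"
      using pp R_in by (auto simp: r_def collapse_rel_def p)
    also have "\<dots> \<longleftrightarrow> m p = m p'"
    proof
      assume eq: "m p = m p'"
      then have "t = t'" using mass_m[of \<alpha> t] mass_m[of \<alpha>' t'] R_in by (simp add: p)
      with eq show "p = p' \<or> (t = 0 \<and> t' = 0)" by (auto simp: p m_def fun_eq_iff)
    qed (auto simp: p m_def)
    finally show ?thesis .
  qed
  ultimately have "quotient_topology C r homeomorphic_space top_of_set (cone_points X)"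
    by (intro homeomorphic_space_if_quotient_maps_same_fibres)
  then show ?thesis
    by (simp add: open_cone_def Let_def C_def r_def geometric_realization_def)
qed

section \<open>Configurations in coordinates\<close>

text \<open>
  Configurations in the coordinate model, as plain functions of (point, cone coordinate). Points
  outside the index range get the value 0, so that equality of configurations is equality of functions.
\<close>

definition config_points :: "nat \<Rightarrow> nat set set \<Rightarrow> (nat \<times> nat \<Rightarrow> real) set" where
  "config_points n X =
     {z. (\<forall>i\<in>{1..n}. (\<lambda>v. z (i, v)) \<in> cone_points X) \<and> (\<forall>i v. i \<notin> {1..n} \<longrightarrow> z (i, v) = 0) \<and>
         inj_on (\<lambda>i v. z (i, v)) {1..n}}"

lemma continuous_map_into_functions:
  "continuous_map X euclidean f \<longleftrightarrow> (\<forall>i. continuous_map X euclidean (\<lambda>x. f x i))"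
  by (metis continuous_map_componentwise_UNIV euclidean_product_topology)

text \<open>
  A homeomorphism of the ambient space is applied to each point of a configuration. Continuity is
  checked coordinatewise; the only bookkeeping is the change of default value, from \<open>undefined\<close> to 0.
\<close>

lemma Conf_homeomorphic_config_points:
  assumes "Z homeomorphic_space top_of_set (cone_points X)"
  shows "Conf n Z homeomorphic_space top_of_set (config_points n X)"
proof -
  obtain f g where fg: "homeomorphic_maps Z (top_of_set (cone_points X)) f g"
    using assms by (auto simp: homeomorphic_space_def)
  then have f: "continuous_map Z (top_of_set (cone_points X)) f"
    and g: "continuous_map (top_of_set (cone_points X)) Z g"
    and gf: "\<And>x. x \<in> topspace Z \<Longrightarrow> g (f x) = x"
    and fg': "\<And>\<beta>. \<beta> \<in> cone_points X \<Longrightarrow> f (g \<beta>) = \<beta>"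
    by (auto simp: homeomorphic_maps_def)
  have f_in: "f x \<in> cone_points X" if "x \<in> topspace Z" for x
    using f that by (auto simp: continuous_map_def)
  have g_in: "g \<beta> \<in> topspace Z" if "\<beta> \<in> cone_points X" for \<beta>
    using g that by (auto simp: continuous_map_def)
  define F where "F = (\<lambda>z (i, v). if i \<in> {1..n} then f (z i) v else 0)"
  define G where "G = (\<lambda>w. \<lambda>i\<in>{1..n}. g (\<lambda>v. w (i, v)))"
  have top: "topspace (Conf n Z) = {z \<in> PiE {1..n} (\<lambda>_. topspace Z). inj_on z {1..n}}"
    by (auto simp: Conf_def)
  have F_in: "F z \<in> config_points n X" if "z \<in> topspace (Conf n Z)" for z
  proof -
    have Z: "z i \<in> topspace Z" if "i \<in> {1..n}" for i
      using that \<open>z \<in> topspace (Conf n Z)\<close> unfolding top by auto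
    have "inj_on z {1..n}" using that by (simp add: top)
    then have "inj_on (\<lambda>i. f (z i)) {1..n}"
      using gf Z by (smt (verit) inj_on_def)
    then have "inj_on (\<lambda>i v. F z (i, v)) {1..n}"
      by (rule inj_on_cong[THEN iffD1, rotated]) (simp add: F_def)
    then show ?thesis using f_in Z by (auto simp: config_points_def F_def)
  qed
  have G_in: "G w \<in> topspace (Conf n Z)" if "w \<in> config_points n X" for w
  proof -
    have "inj_on (G w) {1..n}"
    proof (rule inj_onI)
      fix i j assume ij: "i \<in> {1..n}" "j \<in> {1..n}" "G w i = G w j"
      then have "f (g (\<lambda>v. w (i, v))) = f (g (\<lambda>v. w (j, v)))" by (simp add: G_def)
      then have "(\<lambda>v. w (i, v)) = (\<lambda>v. w (j, v))" using that ij fg' by (simp add: config_points_def)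
      then show "i = j" using that ij by (auto simp: config_points_def dest: inj_onD)
    qed
    then show ?thesis using that g_in by (auto simp: top G_def config_points_def)
  qed
  have "continuous_map (Conf n Z) (top_of_set (config_points n X)) F"
  proof (rule continuous_map_into_subtopology)
    have "continuous_map (Conf n Z) euclidean (\<lambda>z. F z (i, v))" for i v
    proof (cases "i \<in> {1..n}")
      case True
      then have "continuous_map (Conf n Z) Z (\<lambda>z. z i)"
        unfolding Conf_def by (intro continuous_map_from_subtopology continuous_map_product_coordinates)
      then have "continuous_map (Conf n Z) euclidean (f \<circ> (\<lambda>z. z i))"
        using f continuous_map_compose continuous_map_into_fulltopology by blast
      then show ?thesis using True by (auto simp: F_def continuous_map_into_functions o_def)
    next
      case False
      then show ?thesis by (simp only: F_def prod.case if_False) simp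
    qed
    then show "continuous_map (Conf n Z) euclidean F"
      by (auto simp: continuous_map_into_functions)
  qed (use F_in in auto)
  moreover have "continuous_map (top_of_set (config_points n X)) (Conf n Z) G"
    unfolding Conf_def
  proof (rule continuous_map_into_subtopology)
    have "continuous_map (top_of_set (config_points n X)) Z (\<lambda>w. G w i)" if i: "i \<in> {1..n}" for i
    proof -
      have "continuous_map (top_of_set (config_points n X)) (top_of_set (cone_points X)) (\<lambda>w v. w (i, v))"
        using i by (auto simp: config_points_def intro!: continuous_intros)
      then have "continuous_map (top_of_set (config_points n X)) Z (g \<circ> (\<lambda>w v. w (i, v)))"
        using g continuous_map_compose by blast
      then show ?thesis using i by (simp add: G_def o_def)
    qed
    then show "continuous_map (top_of_set (config_points n X)) (product_topology (\<lambda>_. Z) {1..n}) G"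
      by (auto simp: continuous_map_componentwise G_def)
    show "G \<in> topspace (top_of_set (config_points n X)) \<rightarrow> {z. inj_on z {1..n}}"
      using G_in by (auto simp: top)
  qed
  moreover have "G (F z) = z" if "z \<in> topspace (Conf n Z)" for z
  proof
    fix i show "G (F z) i = z i"
      using that gf by (cases "i \<in> {1..n}") (auto simp: top G_def F_def PiE_iff extensional_def)
  qed
  moreover have "F (G w) = w" if "w \<in> config_points n X" for w
  proof
    fix p :: "nat \<times> nat"
    obtain i v where p: "p = (i, v)" by (cases p)
    show "F (G w) p = w p"
      using that fg' by (cases "i \<in> {1..n}") (auto simp: p G_def F_def config_points_def)
  qed
  ultimately have "homeomorphic_maps (Conf n Z) (top_of_set (config_points n X)) F G"
    by (simp add: homeomorphic_maps_def)
  then show ?thesis by (auto simp: homeomorphic_space_def)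
qed

section \<open>Straight-line homotopies\<close>

lemma cone_points_segment:
  assumes K: "simplicial_complex_on V K" and \<sigma>: "\<sigma> \<in> K"
    and \<alpha>: "\<alpha> \<in> cone_points K" "{v. \<alpha> v \<noteq> 0} \<subseteq> \<sigma>" and \<beta>: "\<beta> \<in> cone_points K" "{v. \<beta> v \<noteq> 0} \<subseteq> \<sigma>"
    and t: "t \<in> {0..1}"
  shows "(\<lambda>v. (1 - t) * \<alpha> v + t * \<beta> v) \<in> cone_points K"
proof -
  have "(1 - t) * \<alpha> v + t * \<beta> v = 0" if "v \<notin> \<sigma>" for v
  proof -
    have "\<alpha> v = 0" "\<beta> v = 0" using that \<alpha> \<beta> by auto
    then show ?thesis by simp
  qed
  then have "{v. (1 - t) * \<alpha> v + t * \<beta> v \<noteq> 0} \<subseteq> \<sigma>" by blast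
  then have "{v. (1 - t) * \<alpha> v + t * \<beta> v \<noteq> 0} \<in> K"
    using K \<sigma> unfolding simplicial_complex_on_def by blast
  then show ?thesis using \<alpha> \<beta> t by (auto simp: cone_points_def)
qed

lemma realization_points_segment:
  assumes K: "simplicial_complex_on V K" "finite V" and \<sigma>: "\<sigma> \<in> K"
    and \<alpha>: "\<alpha> \<in> realization_points K" "{v. \<alpha> v \<noteq> 0} \<subseteq> \<sigma>"
    and \<beta>: "\<beta> \<in> realization_points K" "{v. \<beta> v \<noteq> 0} \<subseteq> \<sigma>"
    and t: "t \<in> {0..1}"
  shows "(\<lambda>v. (1 - t) * \<alpha> v + t * \<beta> v) \<in> realization_points K"
  using cone_points_segment[OF K(1) \<sigma> _ \<alpha>(2) _ \<beta>(2) t] \<alpha>(1) \<beta>(1)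
  by (simp add: mem_realization_points_iff[OF K] sum.distrib sum_distrib_left[symmetric])

lemma homotopic_with_straight_line:
  fixes f g :: "'a::topological_space \<Rightarrow> 'b \<Rightarrow> real"
  assumes f: "continuous_on S f" and g: "continuous_on S g"
    and sub: "\<And>x t. x \<in> S \<Longrightarrow> t \<in> {0..1} \<Longrightarrow> (\<lambda>b. (1 - t) * f x b + t * g x b) \<in> T"
  shows "homotopic_with_canon (\<lambda>_. True) S T f g"
  unfolding homotopic_with_def
proof (intro exI[of _ "\<lambda>(t, x) b. (1 - t) * f x b + t * g x b"] conjI allI ballI TrueI)
  have fst_snd: "continuous_on ({0..1} \<times> S) (\<lambda>p. h (snd p) b)"
    if "continuous_on S h" for h :: "'a \<Rightarrow> 'b \<Rightarrow> real" and b
    using continuous_on_product_then_coordinatewise[OF that]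
    by (rule continuous_on_compose2[OF _ continuous_on_snd[OF continuous_on_id]]) auto
  have "continuous_on ({0..1} \<times> S) (\<lambda>(t, x) b. (1 - t) * f x b + t * g x b)"
    unfolding case_prod_unfold
    by (intro continuous_on_coordinatewise_then_product continuous_on_add continuous_on_mult
        continuous_on_diff continuous_on_const continuous_on_fst continuous_on_id fst_snd f g)
  then show "continuous_map (prod_topology (top_of_set {0..1}) (top_of_set S)) (top_of_set T)
      (\<lambda>(t, x) b. (1 - t) * f x b + t * g x b)"
    using sub by auto
qed auto

section \<open>Chambers of configurations\<close>

text \<open>
  The open set cut out by a tuple: the chambers of the minimal tuples are the members of the cover of
  the configuration space whose nerve is the domination complex.
\<close>

definition chamber :: "nat \<Rightarrow> (nat \<Rightarrow> nat rel) \<Rightarrow> (nat \<times> nat \<Rightarrow> real) set" where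
  "chamber k S = {z. \<forall>v\<in>{1..k}. \<forall>j i. (j, i) \<in> S v \<longrightarrow> j \<noteq> i \<longrightarrow> z (j, v) < z (i, v)}"

text \<open>
  The tuple of orders that compares points by their coordinates, where different points with equal
  coordinate are incomparable. It is the largest tuple whose chamber contains \<open>z\<close>.
\<close>

definition order_type :: "nat \<Rightarrow> nat \<Rightarrow> (nat \<times> nat \<Rightarrow> real) \<Rightarrow> nat \<Rightarrow> nat rel" where
  "order_type n k z =
     (\<lambda>v\<in>{1..k}. {(j, i). j \<in> {1..n} \<and> i \<in> {1..n} \<and> (j = i \<or> z (j, v) < z (i, v))})"

lemma chamber_segment:
  assumes "z \<in> chamber k S" "w \<in> chamber k S" "t \<in> {0..1}"
  shows "(\<lambda>p. (1 - t) * z p + t * w p) \<in> chamber k S"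
proof -
  have "(1 - t) * a + t * b < (1 - t) * a' + t * b'" if "a < a'" "b < b'" for a b a' b' :: real
    using that assms(3)
    by (cases "t = 1") (auto intro!: add_less_le_mono mult_strict_left_mono mult_left_mono)
  then show ?thesis using assms by (auto simp: chamber_def)
qed

locale cone_configurations =
  fixes X :: "nat set set" and n k :: nat
  assumes n_pos: "n \<ge> 1" and k_pos: "k \<ge> 1" and X: "simplicial_complex_on {1..k} X"
begin

abbreviation "tuples \<equiv> poset_tuples n k X"
abbreviation "vertices \<equiv> minimal_tuples n k X"
abbreviation "L \<equiv> domination_complex n k X"
abbreviation "configs \<equiv> config_points n X"

lemma tuple_order:
  assumes "S \<in> tuples" "v \<in> {1..k}"
  shows "S v \<subseteq> {1..n} \<times> {1..n}" "i \<in> {1..n} \<Longrightarrow> (i, i) \<in> S v" "trans (S v)" "antisym (S v)"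
proof -
  have "partial_order_on {1..n} (S v)"
    using assms by (auto simp: poset_tuples_def poset_structures_def)
  then show "S v \<subseteq> {1..n} \<times> {1..n}" "i \<in> {1..n} \<Longrightarrow> (i, i) \<in> S v" "trans (S v)" "antisym (S v)"
    by (auto simp: partial_order_on_def preorder_on_def refl_on_def)
qed

lemma finite_tuples: "finite tuples"
proof (rule finite_subset)
  show "tuples \<subseteq> {1..k} \<rightarrow>\<^sub>E Pow ({1..n} \<times> {1..n})"
  proof
    fix S assume S: "S \<in> tuples"
    then have "S \<in> {1..k} \<rightarrow>\<^sub>E poset_structures n" by (simp add: poset_tuples_def)
    then show "S \<in> {1..k} \<rightarrow>\<^sub>E Pow ({1..n} \<times> {1..n})"
      using tuple_order(1)[OF S] by (auto simp: PiE_iff)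
  qed
qed (auto intro: finite_PiE)

lemma vertices_subset_tuples: "vertices \<subseteq> tuples"
  by (auto simp: minimal_tuples_def)

lemma finite_vertices: "finite vertices"
  using finite_tuples vertices_subset_tuples by (rule finite_subset[rotated])

lemma support_mono: "tuple_le k S T \<Longrightarrow> support k S i \<subseteq> support k T i"
  unfolding support_def tuple_le_def by blast

lemma downset_in_X: "\<sigma> \<in> X \<Longrightarrow> \<tau> \<subseteq> \<sigma> \<Longrightarrow> \<tau> \<in> X"
  using X by (auto simp: simplicial_complex_on_def)

text \<open>
  A tuple of least total cardinality among the tuples below \<open>S\<close> is minimal.
\<close>

lemma exists_vertex_below:
  assumes "S \<in> tuples"
  obtains M where "M \<in> vertices" "tuple_le k M S"
proof -
  define size where "size T = (\<Sum>v\<in>{1..k}. card (T v))" for T :: "nat \<Rightarrow> nat rel"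
  define M where "M = arg_min size (\<lambda>T. T \<in> tuples \<and> tuple_le k T S)"
  have "S \<in> tuples \<and> tuple_le k S S" using assms by (simp add: tuple_le_def)
  from arg_min_nat_lemma[where P = "\<lambda>T. T \<in> tuples \<and> tuple_le k T S", OF this]
  have M: "M \<in> tuples" "tuple_le k M S"
    and least: "\<And>T. T \<in> tuples \<Longrightarrow> tuple_le k T S \<Longrightarrow> size M \<le> size T"
    unfolding M_def by blast+
  have "T = M" if T: "T \<in> tuples" "tuple_le k T M" for T
  proof -
    have fin: "finite (M v)" if "v \<in> {1..k}" for v
      using tuple_order(1)[OF M(1) that] finite_subset by blast
    have sub: "T v \<subseteq> M v" if "v \<in> {1..k}" for v
      using T that by (simp add: tuple_le_def)
    have "tuple_le k T S" using T M by (auto simp: tuple_le_def)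
    with least T have "size M \<le> size T" by blast
    have eq: "T v = M v" if v: "v \<in> {1..k}" for v
    proof (rule ccontr)
      assume "T v \<noteq> M v"
      then have "card (T v) < card (M v)"
        using sub fin v by (intro psubset_card_mono) auto
      then have "size T < size M"
        unfolding size_def using v fin sub
        by (intro sum_strict_mono_ex1) (blast intro: card_mono)+
      with \<open>size M \<le> size T\<close> show False by simp
    qed
    show "T = M"
      using T(1) M(1) eq by (intro PiE_ext[of T "{1..k}" "\<lambda>_. poset_structures n" M])
        (auto simp: poset_tuples_def)
  qed
  then have "M \<in> vertices" using M by (auto simp: minimal_tuples_def)
  then show thesis using M that by blast
qed

lemma config_nonneg: "z \<in> configs \<Longrightarrow> i \<in> {1..n} \<Longrightarrow> z (i, v) \<ge> 0"
  by (auto simp: config_points_def cone_points_def)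

text \<open>
  If \<open>i\<close> lies strictly above some \<open>j\<close> in \<open>S v\<close>, then its coordinate exceeds that of \<open>j\<close>, which is
  nonnegative. So a tuple whose chamber contains \<open>z\<close> supports \<open>i\<close> only within the face spanned by the
  \<open>i\<close>-th point.
\<close>

lemma support_in_chamber:
  assumes z: "z \<in> configs" "z \<in> chamber k S" and S: "S \<in> tuples" and v: "v \<in> support k S i"
  shows "z (i, v) \<noteq> 0"
proof -
  obtain j where j: "v \<in> {1..k}" "(j, i) \<in> S v" "j \<noteq> i"
    using v by (auto simp: support_def)
  then have "j \<in> {1..n}" using tuple_order(1)[OF S] by blast
  then have "z (j, v) \<ge> 0" using config_nonneg[OF z(1)] by blast
  moreover have "z (j, v) < z (i, v)" using z(2) j by (auto simp: chamber_def)
  ultimately show ?thesis by simp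
qed

text \<open>
  Any two points are comparable somewhere because distinct points differ in some coordinate, and
  supports are faces because a point above another one in coordinate \<open>v\<close> has a positive \<open>v\<close>-th
  coordinate.
\<close>

lemma order_type_in_tuples:
  assumes z: "z \<in> configs"
  shows "order_type n k z \<in> tuples"
proof -
  have "partial_order_on {1..n} (order_type n k z v)" if "v \<in> {1..k}" for v
    using that
    by (auto simp: order_type_def partial_order_on_def preorder_on_def refl_on_def trans_def antisym_def)
  then have PiE: "order_type n k z \<in> {1..k} \<rightarrow>\<^sub>E poset_structures n"
    by (auto simp: PiE_iff poset_structures_def order_type_def)
  have "\<exists>v\<in>{1..k}. (i, j) \<in> order_type n k z v \<or> (j, i) \<in> order_type n k z v"
    if ij: "i \<in> {1..n}" "j \<in> {1..n}" for i j
  proof (cases "i = j")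
    case True
    then show ?thesis using k_pos ij by (auto simp: order_type_def)
  next
    case False
    then have "(\<lambda>v. z (i, v)) \<noteq> (\<lambda>v. z (j, v))"
      using z ij by (auto simp: config_points_def dest: inj_onD)
    then obtain v where v: "z (i, v) \<noteq> z (j, v)" by auto
    moreover have "z (l, v) = 0" if "v \<notin> {1..k}" "l \<in> {1..n}" for l
    proof -
      have "{v. z (l, v) \<noteq> 0} \<in> X" using z that by (auto simp: config_points_def cone_points_def)
      then have "{v. z (l, v) \<noteq> 0} \<subseteq> {1..k}" using X by (auto simp: simplicial_complex_on_def)
      then show ?thesis using that by blast
    qed
    ultimately have "v \<in> {1..k}" using ij by metis
    then show ?thesis using v ij by (intro bexI[of _ v]) (auto simp: order_type_def)
  qed
  moreover have "support k (order_type n k z) i \<in> X" if i: "i \<in> {1..n}" for i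
  proof (rule downset_in_X)
    show "{v. z (i, v) \<noteq> 0} \<in> X" using z i by (auto simp: config_points_def cone_points_def)
    show "support k (order_type n k z) i \<subseteq> {v. z (i, v) \<noteq> 0}"
    proof
      fix v assume "v \<in> support k (order_type n k z) i"
      then obtain j where "j \<in> {1..n}" "z (j, v) < z (i, v)"
        by (auto simp: support_def order_type_def)
      then show "v \<in> {v. z (i, v) \<noteq> 0}" using config_nonneg[OF z, of j v] by auto
    qed
  qed
  ultimately show ?thesis using PiE by (auto simp: poset_tuples_def)
qed

lemma chamber_iff:
  assumes "S \<in> tuples"
  shows "z \<in> chamber k S \<longleftrightarrow> tuple_le k S (order_type n k z)"
proof
  show "tuple_le k S (order_type n k z)" if "z \<in> chamber k S"
    using that tuple_order(1)[OF assms]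
    by (fastforce simp: chamber_def tuple_le_def order_type_def)
  show "z \<in> chamber k S" if "tuple_le k S (order_type n k z)"
    using that by (fastforce simp: chamber_def tuple_le_def order_type_def)
qed

text \<open>
  Two points that are comparable in coordinate \<open>v\<close> have different \<open>v\<close>-th coordinates in the chamber.
\<close>

lemma chamber_inj:
  assumes "S \<in> tuples" "z \<in> chamber k S"
  shows "inj_on (\<lambda>i v. z (i, v)) {1..n}"
proof (rule inj_onI, rule ccontr)
  fix i j assume ij: "i \<in> {1..n}" "j \<in> {1..n}" "(\<lambda>v. z (i, v)) = (\<lambda>v. z (j, v))" "i \<noteq> j"
  then obtain v where "v \<in> {1..k}" "(i, j) \<in> S v \<or> (j, i) \<in> S v"
    using assms(1) unfolding poset_tuples_def by blast
  then have "z (i, v) \<noteq> z (j, v)"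
    using assms(2) ij(4) by (fastforce simp: chamber_def)
  then show False using ij(3) by metis
qed

lemma exists_chamber:
  assumes "z \<in> configs"
  obtains M where "M \<in> vertices" "z \<in> chamber k M"
proof -
  obtain M where M: "M \<in> vertices" "tuple_le k M (order_type n k z)"
    by (rule exists_vertex_below[OF order_type_in_tuples[OF assms]])
  then have "z \<in> chamber k M" using chamber_iff vertices_subset_tuples by blast
  then show thesis using M that by blast
qed

text \<open>
  All tuples whose chamber contains \<open>z\<close> are dominated by the order type of \<open>z\<close>. Hence the domination
  complex contains the nerve of the cover by chambers of minimal tuples.
\<close>

lemma chambers_form_face:
  assumes "z \<in> configs"
  shows "{M \<in> vertices. z \<in> chamber k M} \<in> L"
  using order_type_in_tuples[OF assms] chamber_iff vertices_subset_tuples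
  by (auto simp: domination_complex_def)

text \<open>
  The points $1, \ldots, n$ of the ray over the vertex 1. This provides a tuple, without which the
  domination complex would lack even the empty face.
\<close>

lemma configs_nonempty: "configs \<noteq> {}"
proof -
  define z :: "nat \<times> nat \<Rightarrow> real" where "z = (\<lambda>(i, v). if i \<in> {1..n} \<and> v = 1 then real i else 0)"
  have "{1} \<in> X" using X k_pos by (auto simp: simplicial_complex_on_def)
  then have "{v. z (i, v) \<noteq> 0} \<in> X" for i
    by (rule downset_in_X) (auto simp: z_def)
  moreover have "z p \<ge> 0" for p
    by (cases p) (simp add: z_def)
  moreover have "z (i, v) = 0" if "i \<notin> {1..n}" for i v
    using that by (simp only: z_def prod.case) simp
  moreover have "inj_on (\<lambda>i v. z (i, v)) {1..n}"
  proof (rule inj_onI)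
    fix i j assume ij: "i \<in> {1..n}" "j \<in> {1..n}" "(\<lambda>v. z (i, v)) = (\<lambda>v. z (j, v))"
    then have "z (i, 1) = z (j, 1)" by metis
    then show "i = j" using ij by (simp add: z_def)
  qed
  ultimately have "z \<in> configs"
    by (simp add: config_points_def cone_points_def)
  then show ?thesis by blast
qed

lemma simplicial_domination_complex: "simplicial_complex_on vertices L"
proof -
  have "{} \<in> L" using configs_nonempty order_type_in_tuples by (auto simp: domination_complex_def)
  moreover have "{M} \<in> L" if "M \<in> vertices" for M
    using that vertices_subset_tuples by (auto simp: domination_complex_def tuple_le_def)
  moreover have "finite A" if "A \<in> L" for A
    using that finite_vertices finite_subset by (auto simp: domination_complex_def)
  moreover have "B \<in> L" if "A \<in> L" "B \<subseteq> A" for A B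
    using that unfolding domination_complex_def by blast
  moreover have "L \<subseteq> Pow vertices" by (auto simp: domination_complex_def)
  ultimately show ?thesis
    unfolding simplicial_complex_on_def by blast
qed

lemma finite_domination_complex: "finite L"
  using finite_vertices by (rule finite_subset[rotated, OF finite_Pow_iff[THEN iffD2]])
    (auto simp: domination_complex_def)

lemmas mem_realization_iff = mem_realization_points_iff[OF simplicial_domination_complex finite_vertices]

section \<open>From configurations to the complex: a partition of unity\<close>

text \<open>
  A continuous function of \<open>z\<close> that vanishes exactly off the chamber of \<open>M\<close>. As the chambers of the
  minimal tuples cover, these functions normalize to a partition of unity.
\<close>

definition gap_product :: "(nat \<times> nat \<Rightarrow> real) \<Rightarrow> (nat \<Rightarrow> nat rel) \<Rightarrow> real" where
  "gap_product z M =
     (if M \<in> vertices then \<Prod>v\<in>{1..k}. \<Prod>(j, i)\<in>M v - Id. max 0 (z (i, v) - z (j, v)) else 0)"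

lemma gap_product_nonneg: "gap_product z M \<ge> 0"
  by (auto simp: gap_product_def intro!: prod_nonneg)

lemma gap_product_nonzero_iff: "gap_product z M \<noteq> 0 \<longleftrightarrow> M \<in> vertices \<and> z \<in> chamber k M"
proof (cases "M \<in> vertices")
  case True
  have fin: "finite (M v - Id)" if "v \<in> {1..k}" for v
    using tuple_order(1)[OF subsetD[OF vertices_subset_tuples True] that]
    by (meson finite_Diff finite_SigmaI finite_atLeastAtMost finite_subset)
  have max: "max 0 (b - a) \<noteq> 0 \<longleftrightarrow> a < b" for a b :: real by auto
  have "gap_product z M \<noteq> 0 \<longleftrightarrow>
      (\<forall>v\<in>{1..k}. \<forall>p\<in>M v - Id. (case p of (j, i) \<Rightarrow> max 0 (z (i, v) - z (j, v))) \<noteq> 0)"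
    using True fin by (simp add: gap_product_def prod_zero_iff)
  also have "\<dots> \<longleftrightarrow> (\<forall>v\<in>{1..k}. \<forall>j i. (j, i) \<in> M v \<longrightarrow> j \<noteq> i \<longrightarrow> max 0 (z (i, v) - z (j, v)) \<noteq> 0)"
    by (simp only: split_paired_All Ball_def prod.case Diff_iff pair_in_Id_conv imp_conjL)
  also have "\<dots> \<longleftrightarrow> z \<in> chamber k M"
    unfolding max chamber_def by simp
  finally show ?thesis using True by simp
qed (simp add: gap_product_def)

lemma gap_product_in_cone: "z \<in> configs \<Longrightarrow> gap_product z \<in> cone_points L"
  using chambers_form_face by (auto simp: cone_points_def gap_product_nonneg gap_product_nonzero_iff)

definition nerve_map :: "(nat \<times> nat \<Rightarrow> real) \<Rightarrow> (nat \<Rightarrow> nat rel) \<Rightarrow> real" where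
  "nerve_map z = (\<lambda>M. gap_product z M / (\<Sum>M\<in>vertices. gap_product z M))"

lemma gap_sum_pos: "z \<in> configs \<Longrightarrow> (\<Sum>M\<in>vertices. gap_product z M) > 0"
  using exists_chamber gap_product_nonzero_iff
    sum_pos_cone_points[OF simplicial_domination_complex finite_vertices gap_product_in_cone]
  by metis

lemma nerve_map_in_realization: "z \<in> configs \<Longrightarrow> nerve_map z \<in> realization_points L"
  unfolding nerve_map_def using exists_chamber gap_product_nonzero_iff
    normalized_mem_realization_points[OF simplicial_domination_complex finite_vertices gap_product_in_cone]
  by metis

lemma nerve_map_nonzero_iff:
  "z \<in> configs \<Longrightarrow> nerve_map z M \<noteq> 0 \<longleftrightarrow> M \<in> vertices \<and> z \<in> chamber k M"
  using gap_sum_pos[of z] by (simp add: nerve_map_def gap_product_nonzero_iff[symmetric])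

lemma continuous_on_nerve_map: "continuous_on configs nerve_map"
proof -
  have gap: "continuous_on configs (\<lambda>z. gap_product z M)" for M
  proof (cases "M \<in> vertices")
    case True
    then show ?thesis
      unfolding gap_product_def case_prod_unfold
      by (simp only: if_True) (intro continuous_on_prod continuous_on_max continuous_on_const
          continuous_on_diff continuous_on_coordinate)
  qed (simp add: gap_product_def)
  have "(\<Sum>M\<in>vertices. gap_product z M) \<noteq> 0" if "z \<in> configs" for z
    using gap_sum_pos[OF that] by simp
  then show ?thesis
    unfolding nerve_map_def
    by (intro continuous_on_coordinatewise_then_product continuous_on_divide continuous_on_sum gap) auto
qed

section \<open>From the complex to configurations\<close>

definition dominator :: "(nat \<Rightarrow> nat rel) set \<Rightarrow> nat \<Rightarrow> nat rel" where
  "dominator A = (SOME T. T \<in> tuples \<and> (\<forall>S\<in>A. tuple_le k S T))"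

lemma dominator:
  assumes "A \<in> L"
  shows "dominator A \<in> tuples" "S \<in> A \<Longrightarrow> tuple_le k S (dominator A)"
proof -
  have "\<exists>T. T \<in> tuples \<and> (\<forall>S\<in>A. tuple_le k S T)"
    using assms by (auto simp: domination_complex_def)
  then have "dominator A \<in> tuples \<and> (\<forall>S\<in>A. tuple_le k S (dominator A))"
    unfolding dominator_def by (rule someI_ex)
  then show "dominator A \<in> tuples" "S \<in> A \<Longrightarrow> tuple_le k S (dominator A)" by auto
qed

text \<open>
  For a nonempty face \<open>A\<close>, a configuration in the common chamber of its vertices, with the sizes of
  down-sets in a dominating tuple as coordinates. Coordinates that no member of \<open>A\<close> supports are set
  to 0: then the support of the configuration is that of \<open>A\<close> itself, whichever dominating tuple is
  chosen.
\<close>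

definition height :: "(nat \<Rightarrow> nat rel) set \<Rightarrow> nat \<times> nat \<Rightarrow> real" where
  "height A = (\<lambda>(i, v). if \<exists>M\<in>A. v \<in> support k M i
     then real (card {j. (j, i) \<in> dominator A v}) else 0)"

lemma height_bounds:
  assumes "A \<in> L"
  shows "0 \<le> height A p" "height A p \<le> real n"
proof -
  obtain i v where p: "p = (i, v)" by (cases p)
  show "0 \<le> height A p" by (simp add: p height_def)
  show "height A p \<le> real n"
  proof (cases "v \<in> {1..k}")
    case True
    then have "{j. (j, i) \<in> dominator A v} \<subseteq> {1..n}"
      using tuple_order(1)[OF dominator(1)[OF assms]] by blast
    from card_mono[OF _ this] show ?thesis by (simp add: p height_def)
  next
    case False
    then show ?thesis by (auto simp: p height_def support_def)
  qed
qed

lemma height_gap: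
  assumes A: "A \<in> L" and M: "M \<in> A" and v: "v \<in> {1..k}" and ji: "(j, i) \<in> M v" "j \<noteq> i"
  shows "height A (j, v) + 1 \<le> height A (i, v)"
proof -
  let ?T = "dominator A v" and ?down = "\<lambda>i. {l. (l, i) \<in> dominator A v}"
  note T = tuple_order[OF dominator(1)[OF A] v]
  have ji_T: "(j, i) \<in> ?T" using dominator(2)[OF A M] v ji by (auto simp: tuple_le_def)
  then have i: "i \<in> {1..n}" using T(1) by auto
  have "?down j \<subseteq> ?down i" using ji_T T(3) by (auto dest: transD)
  moreover have "i \<in> ?down i" "i \<notin> ?down j" using T(2)[OF i] T(4) ji_T ji(2) by (auto dest: antisymD)
  ultimately have "?down j \<subset> ?down i" by blast
  moreover have "?down i \<subseteq> {1..n}" using T(1) by blast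
  then have "finite (?down i)" using finite_subset by blast
  ultimately have "card (?down j) < card (?down i)" by (rule psubset_card_mono[rotated])
  moreover have "height A (j, v) \<le> real (card (?down j))" by (simp add: height_def)
  moreover have "v \<in> support k M i" using v ji by (auto simp: support_def)
  then have "height A (i, v) = real (card (?down i))" using M by (auto simp: height_def)
  ultimately show ?thesis by linarith
qed

text \<open>
  The weight and the threshold are tuned to each other: \<open>weight * threshold = n\<close> bounds all heights,
  while the coordinates of a point of the realization, summing up to 1, cannot all be at most the
  threshold, half of their average.
\<close>

definition weight :: real where
  "weight = 2 * real n * real (card vertices)"

definition threshold :: real where
  "threshold = 1 / (2 * real (card vertices))"

text \<open>
  A combination of the height configurations of all faces spanned by the support of \<open>\<alpha>\<close>. It is
  polynomial in \<open>\<alpha>\<close>, and the powers of the weight let larger faces dominate smaller ones.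
\<close>

definition config_map :: "((nat \<Rightarrow> nat rel) \<Rightarrow> real) \<Rightarrow> nat \<times> nat \<Rightarrow> real" where
  "config_map \<alpha> = (\<lambda>p. \<Sum>A\<in>L. weight ^ card A * (\<Prod>M\<in>A. \<alpha> M) * height A p)"

lemma card_vertices_pos: "card vertices > 0"
  using configs_nonempty exists_chamber finite_vertices by (metis card_gt_0_iff empty_iff equals0I)

lemma weight_pos: "weight > 0"
  using n_pos card_vertices_pos by (simp add: weight_def)

lemma realization_nonneg: "\<alpha> \<in> realization_points L \<Longrightarrow> \<alpha> M \<ge> 0"
  by (simp add: realization_points_def)

lemma realization_support: "\<alpha> \<in> realization_points L \<Longrightarrow> {M. \<alpha> M \<noteq> 0} \<in> L"
  by (simp add: realization_points_def)

lemma faces: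
  assumes "A \<in> L"
  shows "finite A" "A \<subseteq> vertices" "B \<subseteq> A \<Longrightarrow> B \<in> L"
proof -
  show "A \<subseteq> vertices" using assms by (auto simp: domination_complex_def)
  then show "finite A" using finite_vertices finite_subset by blast
  show "B \<in> L" if "B \<subseteq> A" using assms that unfolding domination_complex_def by blast
qed

text \<open>
  The faces that contribute are paired as \<open>A\<close> and \<open>insert M A\<close> with \<open>M \<notin> A\<close>. Passing from \<open>A\<close> to
  \<open>insert M A\<close> multiplies the coefficient by \<open>weight * \<alpha> M > n\<close>. For \<open>j\<close> below \<open>i\<close> in \<open>M v\<close> the height
  difference is at least 1 for \<open>insert M A\<close> and at least \<open>-n\<close> for \<open>A\<close>, so each pair contributes a
  positive amount to the difference of the coordinates of \<open>i\<close> and \<open>j\<close>.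
\<close>

lemma config_map_in_chamber:
  assumes \<alpha>: "\<alpha> \<in> realization_points L" and M: "\<alpha> M > threshold"
  shows "config_map \<alpha> \<in> chamber k M"
proof -
  define \<sigma> where "\<sigma> = {M. \<alpha> M \<noteq> 0}"
  have \<sigma>: "\<sigma> \<in> L" using realization_support[OF \<alpha>] by (simp add: \<sigma>_def)
  note pos = realization_nonneg[OF \<alpha>]
  have "threshold > 0" using card_vertices_pos by (simp add: threshold_def)
  then have M\<sigma>: "M \<in> \<sigma>" using M by (simp add: \<sigma>_def)
  have large: "weight * \<alpha> M > real n"
  proof -
    have "weight * threshold = real n" using card_vertices_pos by (simp add: weight_def threshold_def)
    then show ?thesis using mult_strict_left_mono[OF M weight_pos] by simp
  qed
  define c where "c A = weight ^ card A * (\<Prod>M\<in>A. \<alpha> M)" for A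
  have c_insert: "c (insert M A) = weight * \<alpha> M * c A" if "A \<subseteq> \<sigma> - {M}" for A
  proof -
    have "finite A" "M \<notin> A" using that faces(1)[OF \<sigma>] finite_subset by blast+
    then show ?thesis by (simp add: c_def)
  qed
  have c_pos: "c A > 0" if "A \<subseteq> \<sigma>" for A
    using that pos weight_pos unfolding c_def \<sigma>_def
    by (intro mult_pos_pos zero_less_power prod_pos) (auto simp: less_le)
  have "config_map \<alpha> (j, v) < config_map \<alpha> (i, v)"
    if v: "v \<in> {1..k}" and ji: "(j, i) \<in> M v" "j \<noteq> i" for i j v
  proof -
    define d where "d A = height A (i, v) - height A (j, v)" for A
    have "config_map \<alpha> (i, v) - config_map \<alpha> (j, v) = (\<Sum>A\<in>L. c A * d A)"
      by (simp add: config_map_def c_def d_def sum_subtractf right_diff_distrib)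
    also have "\<dots> = (\<Sum>A\<in>Pow \<sigma>. c A * d A)"
    proof (rule sum.mono_neutral_right[OF finite_domination_complex])
      show "Pow \<sigma> \<subseteq> L" using faces(3)[OF \<sigma>] by blast
      \<comment> \<open>Every other face has a vertex at which the coordinate of \<open>\<alpha>\<close> vanishes.\<close>
      show "\<forall>A\<in>L - Pow \<sigma>. c A * d A = 0"
      proof
        fix A assume A: "A \<in> L - Pow \<sigma>"
        then have "\<exists>M\<in>A. \<alpha> M = 0" by (auto simp: \<sigma>_def)
        then have "(\<Prod>M\<in>A. \<alpha> M) = 0" using A faces(1) by (intro prod_zero) auto
        then show "c A * d A = 0" by (simp add: c_def)
      qed
    qed
    also have "Pow \<sigma> = Pow (\<sigma> - {M}) \<union> insert M ` Pow (\<sigma> - {M})"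
      using Pow_insert[of M "\<sigma> - {M}"] M\<sigma> by (simp add: insert_absorb)
    also have "(\<Sum>A\<in>\<dots>. c A * d A) =
        (\<Sum>A\<in>Pow (\<sigma> - {M}). c A * d A) + (\<Sum>A\<in>insert M ` Pow (\<sigma> - {M}). c A * d A)"
      using faces(1)[OF \<sigma>] by (intro sum.union_disjoint) auto
    also have "(\<Sum>A\<in>insert M ` Pow (\<sigma> - {M}). c A * d A) =
        (\<Sum>A\<in>Pow (\<sigma> - {M}). c (insert M A) * d (insert M A))"
    proof (subst sum.reindex)
      show "inj_on (insert M) (Pow (\<sigma> - {M}))" by (auto simp: inj_on_def)
    qed simp
    also have "(\<Sum>A\<in>Pow (\<sigma> - {M}). c A * d A) + (\<Sum>A\<in>Pow (\<sigma> - {M}). c (insert M A) * d (insert M A)) =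
        (\<Sum>A\<in>Pow (\<sigma> - {M}). c A * d A + c (insert M A) * d (insert M A))"
      by (simp add: sum.distrib)
    also have "\<dots> > 0"
    proof (rule sum_pos)
      fix A assume "A \<in> Pow (\<sigma> - {M})"
      then have A: "A \<subseteq> \<sigma> - {M}" by simp
      then have "insert M A \<subseteq> \<sigma>" using M\<sigma> by blast
      then have AL: "A \<in> L" "insert M A \<in> L" using faces(3)[OF \<sigma>] by blast+
      have "d A \<ge> - real n"
        using height_bounds[OF AL(1), of "(i, v)"] height_bounds[OF AL(1), of "(j, v)"] by (simp add: d_def)
      moreover have "d (insert M A) \<ge> 1"
        using height_gap[OF AL(2) insertI1 v ji] by (simp add: d_def)
      then have "weight * \<alpha> M * d (insert M A) \<ge> weight * \<alpha> M"
        using mult_left_mono[of 1 "d (insert M A)" "weight * \<alpha> M"] weight_pos pos[of M] by simp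
      ultimately have "d A + weight * \<alpha> M * d (insert M A) > 0" using large by linarith
      moreover have "c A > 0" using A by (intro c_pos) auto
      moreover have "c A * d A + c (insert M A) * d (insert M A) = c A * (d A + weight * \<alpha> M * d (insert M A))"
        by (simp add: c_insert[OF A] algebra_simps)
      ultimately show "c A * d A + c (insert M A) * d (insert M A) > 0" by simp
    qed (use faces(1)[OF \<sigma>] in auto)
    finally show ?thesis by simp
  qed
  then show ?thesis by (auto simp: chamber_def)
qed

lemma exists_above_threshold:
  assumes \<alpha>: "\<alpha> \<in> realization_points L"
  obtains M where "M \<in> vertices" "\<alpha> M > threshold"
proof -
  have "\<exists>M\<in>vertices. \<alpha> M > threshold"
  proof (rule ccontr)
    assume "\<not> ?thesis"
    then have "(\<Sum>M\<in>vertices. \<alpha> M) \<le> (\<Sum>M\<in>vertices. threshold)"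
      by (intro sum_mono) (auto simp: not_less)
    also have "\<dots> = 1 / 2" using card_vertices_pos by (simp add: threshold_def)
    finally show False using \<alpha> by (simp add: mem_realization_iff)
  qed
  then show thesis using that by blast
qed

lemma config_map_nonzero:
  assumes "config_map \<alpha> (i, v) \<noteq> 0"
  obtains M where "\<alpha> M \<noteq> 0" "v \<in> support k M i"
proof -
  from assms obtain A where A: "A \<in> L" "(\<Prod>M\<in>A. \<alpha> M) \<noteq> 0" "height A (i, v) \<noteq> 0"
    unfolding config_map_def by (metis (no_types, lifting) mult_eq_0_iff sum.neutral)
  then obtain M where "M \<in> A" "v \<in> support k M i"
    by (auto simp: height_def split: if_splits)
  moreover have "\<alpha> M \<noteq> 0" using A \<open>M \<in> A\<close> faces(1) prod_zero by metis
  ultimately show thesis using that by blast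
qed

text \<open>
  Supports are controlled by a tuple dominating the whole support of \<open>\<alpha>\<close>, and the points are distinct
  because a single vertex above the threshold already puts the configuration into a chamber.
\<close>

lemma config_map_in_configs:
  assumes \<alpha>: "\<alpha> \<in> realization_points L"
  shows "config_map \<alpha> \<in> configs"
proof -
  let ?T = "dominator {M. \<alpha> M \<noteq> 0}"
  note T = dominator[OF realization_support[OF \<alpha>]]
  have supp: "{v. config_map \<alpha> (i, v) \<noteq> 0} \<subseteq> support k ?T i" for i
  proof
    fix v assume "v \<in> {v. config_map \<alpha> (i, v) \<noteq> 0}"
    then have "config_map \<alpha> (i, v) \<noteq> 0" by simp
    then obtain M where M: "\<alpha> M \<noteq> 0" "v \<in> support k M i" by (rule config_map_nonzero)
    then have "tuple_le k M ?T" using T(2) by simp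
    then show "v \<in> support k ?T i" using M support_mono by blast
  qed
  have "support k ?T i = {}" if "i \<notin> {1..n}" for i
    using tuple_order(1)[OF T(1)] that unfolding support_def by blast
  then have "config_map \<alpha> (i, v) = 0" if "i \<notin> {1..n}" for i v
    using supp[of i] that by blast
  moreover have "config_map \<alpha> p \<ge> 0" for p
    unfolding config_map_def using weight_pos realization_nonneg[OF \<alpha>] height_bounds
    by (intro sum_nonneg mult_nonneg_nonneg prod_nonneg) auto
  moreover have "{v. config_map \<alpha> (i, v) \<noteq> 0} \<in> X" if "i \<in> {1..n}" for i
    using T(1) that by (intro downset_in_X[OF _ supp]) (auto simp: poset_tuples_def)
  moreover have "inj_on (\<lambda>i v. config_map \<alpha> (i, v)) {1..n}"
  proof -
    obtain M where M: "M \<in> vertices" "\<alpha> M > threshold" by (rule exists_above_threshold[OF \<alpha>])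
    show ?thesis
      using chamber_inj[OF subsetD[OF vertices_subset_tuples M(1)] config_map_in_chamber[OF \<alpha> M(2)]] .
  qed
  ultimately show ?thesis
    by (auto simp: config_points_def cone_points_def)
qed

lemma continuous_on_config_map: "continuous_on S config_map"
  unfolding config_map_def
  by (intro continuous_on_coordinatewise_then_product continuous_on_sum continuous_on_mult
      continuous_on_prod continuous_on_const continuous_on_coordinate)

section \<open>The homotopy equivalence\<close>

text \<open>
  Any vertex \<open>M\<close> above the threshold in \<open>nerve_map z\<close> has both \<open>z\<close> and its image in its chamber, which is
  convex; so the segment between them never lets two points collide. It stays in the cone because each
  point of the image has its support inside that of the corresponding point of \<open>z\<close>.
\<close>

lemma config_map_nerve_map_homotopic_id:
  "homotopic_with_canon (\<lambda>_. True) configs configs (config_map \<circ> nerve_map) id"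
proof (rule homotopic_with_straight_line)
  show "continuous_on configs (config_map \<circ> nerve_map)"
    by (intro continuous_on_compose continuous_on_nerve_map continuous_on_config_map)
  show "continuous_on configs id" by (rule continuous_on_id')
  fix z t assume z: "z \<in> configs" and t: "t \<in> {0..1::real}"
  let ?w = "config_map (nerve_map z)" and ?u = "\<lambda>p. (1 - t) * config_map (nerve_map z) p + t * z p"
  note \<alpha> = nerve_map_in_realization[OF z]
  note w = config_map_in_configs[OF \<alpha>]
  obtain M where M: "M \<in> vertices" "nerve_map z M > threshold"
    by (rule exists_above_threshold[OF \<alpha>])
  moreover have "threshold \<ge> 0" by (simp add: threshold_def)
  ultimately have "z \<in> chamber k M" using nerve_map_nonzero_iff[OF z, of M] by auto
  then have "?u \<in> chamber k M"
    using config_map_in_chamber[OF \<alpha> M(2)] t by (intro chamber_segment)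
  then have "inj_on (\<lambda>i v. ?u (i, v)) {1..n}"
    using chamber_inj M(1) vertices_subset_tuples by blast
  moreover have "(\<lambda>v. ?u (i, v)) \<in> cone_points X" if i: "i \<in> {1..n}" for i
  proof (rule cone_points_segment[OF X _ _ _ _ _ t])
    show "{v. z (i, v) \<noteq> 0} \<in> X" "(\<lambda>v. z (i, v)) \<in> cone_points X" "(\<lambda>v. ?w (i, v)) \<in> cone_points X"
      using z w i by (auto simp: config_points_def cone_points_def)
    show "{v. ?w (i, v) \<noteq> 0} \<subseteq> {v. z (i, v) \<noteq> 0}"
    proof
      fix v assume "v \<in> {v. ?w (i, v) \<noteq> 0}"
      then have "?w (i, v) \<noteq> 0" by simp
      then obtain M' where M': "nerve_map z M' \<noteq> 0" "v \<in> support k M' i"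
        by (rule config_map_nonzero)
      then have "M' \<in> tuples" "z \<in> chamber k M'"
        using nerve_map_nonzero_iff[OF z] vertices_subset_tuples by auto
      then show "v \<in> {v. z (i, v) \<noteq> 0}" using support_in_chamber[OF z] M'(2) by simp
    qed
  qed simp
  moreover have "?u (i, v) = 0" if "i \<notin> {1..n}" for i v
    using z w that by (simp add: config_points_def)
  ultimately show "(\<lambda>p. (1 - t) * (config_map \<circ> nerve_map) z p + t * id z p) \<in> configs"
    by (simp add: config_points_def)
qed

text \<open>
  The coordinates that do not exceed the threshold are discarded, and the others renormalized. The
  support shrinks to vertices whose chamber contains \<open>config_map \<alpha>\<close>.
\<close>

definition truncation :: "((nat \<Rightarrow> nat rel) \<Rightarrow> real) \<Rightarrow> (nat \<Rightarrow> nat rel) \<Rightarrow> real" where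
  "truncation \<alpha> = (\<lambda>M. max 0 (\<alpha> M - threshold) / (\<Sum>M\<in>vertices. max 0 (\<alpha> M - threshold)))"

lemma truncation:
  assumes \<alpha>: "\<alpha> \<in> realization_points L"
  shows "(\<Sum>M\<in>vertices. max 0 (\<alpha> M - threshold)) > 0"
    and "truncation \<alpha> \<in> realization_points L"
    and "truncation \<alpha> M \<noteq> 0 \<longleftrightarrow> \<alpha> M > threshold"
proof -
  let ?w = "\<lambda>M. max 0 (\<alpha> M - threshold)"
  have "threshold \<ge> 0" by (simp add: threshold_def)
  then have "{M. ?w M \<noteq> 0} \<subseteq> {M. \<alpha> M \<noteq> 0}" by auto
  then have "{M. ?w M \<noteq> 0} \<in> L" using realization_support[OF \<alpha>] faces(3) by blast
  then have w: "?w \<in> cone_points L" by (auto simp: cone_points_def)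
  obtain M\<^sub>0 where "\<alpha> M\<^sub>0 > threshold" by (rule exists_above_threshold[OF \<alpha>])
  then have nz: "?w M\<^sub>0 \<noteq> 0" by simp
  show pos: "(\<Sum>M\<in>vertices. ?w M) > 0"
    by (rule sum_pos_cone_points[where w = ?w and v = M\<^sub>0, OF simplicial_domination_complex finite_vertices w nz])
  show "truncation \<alpha> \<in> realization_points L" unfolding truncation_def
    by (rule normalized_mem_realization_points[where w = ?w and v = M\<^sub>0, OF simplicial_domination_complex finite_vertices w nz])
  show "truncation \<alpha> M \<noteq> 0 \<longleftrightarrow> \<alpha> M > threshold"
    using pos by (auto simp: truncation_def)
qed

lemma continuous_on_truncation: "continuous_on (realization_points L) truncation"
  unfolding truncation_def using truncation(1)
  by (intro continuous_on_coordinatewise_then_product continuous_on_divide continuous_on_sum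
      continuous_on_max continuous_on_diff continuous_on_const continuous_on_coordinate) fastforce

text \<open>
  The supports of \<open>\<alpha>\<close> and of \<open>nerve_map (config_map \<alpha>)\<close> need not lie in a common face. But the support
  of the truncation of \<open>\<alpha>\<close> is contained in both, so one straight-line homotopy runs within the second
  face to the truncation, and another one within the first face from there to \<open>\<alpha>\<close>.
\<close>

lemma nerve_map_config_map_homotopic_id:
  "homotopic_with_canon (\<lambda>_. True) (realization_points L) (realization_points L) (nerve_map \<circ> config_map) id"
proof (rule homotopic_with_trans)
  let ?R = "realization_points L"
  have segment: "(\<lambda>M. (1 - t) * f \<alpha> M + t * g \<alpha> M) \<in> ?R"
    if "f \<alpha> \<in> ?R" "g \<alpha> \<in> ?R" "t \<in> {0..1}" "{M. g \<alpha> M \<noteq> 0} \<subseteq> {M. f \<alpha> M \<noteq> 0}" for f g \<alpha> t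
    using that realization_support[of "f \<alpha>"]
    by (intro realization_points_segment[OF simplicial_domination_complex finite_vertices]) auto
  have nc: "continuous_on ?R (nerve_map \<circ> config_map)"
    using config_map_in_configs
    by (intro continuous_on_compose continuous_on_config_map
        continuous_on_subset[OF continuous_on_nerve_map]) auto
  show "homotopic_with_canon (\<lambda>_. True) ?R ?R (nerve_map \<circ> config_map) truncation"
  proof (rule homotopic_with_straight_line[OF nc continuous_on_truncation])
    fix \<alpha> t assume \<alpha>: "\<alpha> \<in> ?R" and t: "t \<in> {0..1::real}"
    have "{M. truncation \<alpha> M \<noteq> 0} \<subseteq> {M. (nerve_map \<circ> config_map) \<alpha> M \<noteq> 0}"
    proof
      fix M assume "M \<in> {M. truncation \<alpha> M \<noteq> 0}"
      then have M: "\<alpha> M > threshold" using truncation(3)[OF \<alpha>] by simp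
      moreover have "threshold \<ge> 0" by (simp add: threshold_def)
      ultimately have "M \<in> vertices" using faces(2)[OF realization_support[OF \<alpha>]] by auto
      then show "M \<in> {M. (nerve_map \<circ> config_map) \<alpha> M \<noteq> 0}"
        using nerve_map_nonzero_iff[OF config_map_in_configs[OF \<alpha>]] config_map_in_chamber[OF \<alpha> M] by simp
    qed
    then show "(\<lambda>M. (1 - t) * (nerve_map \<circ> config_map) \<alpha> M + t * truncation \<alpha> M) \<in> ?R"
      using \<alpha> t truncation(2) nerve_map_in_realization config_map_in_configs by (intro segment) auto
  qed
  have "homotopic_with_canon (\<lambda>_. True) ?R ?R id truncation"
  proof (rule homotopic_with_straight_line[OF continuous_on_id' continuous_on_truncation])
    fix \<alpha> t assume \<alpha>: "\<alpha> \<in> ?R" and t: "t \<in> {0..1::real}"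
    have "threshold \<ge> 0" by (simp add: threshold_def)
    then have "{M. truncation \<alpha> M \<noteq> 0} \<subseteq> {M. id \<alpha> M \<noteq> 0}" using truncation(3)[OF \<alpha>] by auto
    then show "(\<lambda>M. (1 - t) * id \<alpha> M + t * truncation \<alpha> M) \<in> ?R"
      using \<alpha> t truncation(2) by (intro segment) auto
  qed
  then show "homotopic_with_canon (\<lambda>_. True) ?R ?R truncation id"
    by (rule homotopic_with_symD)
qed

lemma realization_homotopy_equivalent_configs:
  "top_of_set (realization_points L) homotopy_equivalent_space top_of_set configs"
  unfolding homotopy_equivalent_space_def
proof (intro exI[of _ config_map] exI[of _ nerve_map] conjI)
  show "continuous_map (top_of_set (realization_points L)) (top_of_set configs) config_map"
    using continuous_on_config_map config_map_in_configs by auto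
  show "continuous_map (top_of_set configs) (top_of_set (realization_points L)) nerve_map"
    using continuous_on_nerve_map nerve_map_in_realization by auto
qed (rule nerve_map_config_map_homotopic_id config_map_nerve_map_homotopic_id)+

end

theorem theorem1p12:
  fixes X :: "nat set set" and n k :: nat
  assumes "k \<ge> 1" and "n \<ge> 1"
    and "simplicial_complex_on {1..k} X"
  shows "geometric_realization (domination_complex n k X)
           homotopy_equivalent_space Conf n (open_cone (geometric_realization X))"
proof -
  interpret cone_configurations X n k
    using assms by unfold_locales
  have "open_cone (geometric_realization X) homeomorphic_space top_of_set (cone_points X)"
    using assms by (intro open_cone_homeomorphic_cone_points[of "{1..k}"]) auto
  then have "top_of_set configs homotopy_equivalent_space Conf n (open_cone (geometric_realization X))"
    using Conf_homeomorphic_config_points homeomorphic_imp_homotopy_equivalent_space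
      homotopy_equivalent_space_sym by blast
  with realization_homotopy_equivalent_configs show ?thesis
    unfolding geometric_realization_def by (rule homotopy_eqv_trans)
qed

end
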